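(* Consider the pricing strategy $$p^{BU}_{k,l,t}=v^{BU}_{l,t}-v_{-k}+\Big(\max_{i,j,b}\{L^{b}_{k,i,j}-v^{b}_{i,j}+v_{-k}\}\Big)^{+}$$ for every contract $(l,t,BU)$, where the maximum is over all contracts $(i,j,b)$, $y^+=\max\{y,0\}$, and $L^{b}_{k,i,j}$ is the lowest end-point of the marginal distribution of the utility $U^{b}_{k,i,j}$. This pricing strategy maximizes the ex-post social welfare. The profit of the charging station is $\big(\max_{i,j,b}\{L^{b}_{k,i,j}-v^{b}_{i,j}+v_{-k}\}\big)^{+}$.
   Context: User $k$ arrives at a charging station at time $t_k$ and is offered contracts $(l,t,BU)$ with $l\in\{1,\dots,L\}$ (energy), $t\in\{t_k+1,\dots,T\}$ (deadline), $BU\in\{0,\dots,BU_{max}\}$ (maximum additional battery utilization), at prices $p^{BU}_{k,l,t}$. User: the utility of contract $(l,t,BU)$ is a random variable $U^{BU}_{k,l,t}$ with realized value $u^{BU}_{k,l,t}$, known to the user only. Her payoff from the contract is $u^{BU}_{k,l,t}-p^{BU}_{k,l,t}$, and $0$ if she rejects all. She chooses $A^{BU}_{k,l,t}(\mathbf p_k)\in[0,1]$ with $\sum_{l,t,BU}A^{BU}_{k,l,t}\le1$ maximizing $\sum_{l,t,BU}A^{BU}_{k,l,t}(u^{BU}_{k,l,t}-p^{BU}_{k,l,t})$; if the maximum payoff over contracts is negative she rejects all, and if it is $0$ she accepts (ties between accepting and rejecting are resolved by accepting). Among several maximum-payoff contracts any convex combination may be chosen. Station: $v^{BU}_{l,t}$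 is the optimal value of the linear program $\mathcal P^{BU}_{l,t}$ below (equal to $\infty$ if infeasible), and $v_{-k}$ is the optimal value when user $k$ accepts no contract, i.e. of the same program with $r_{k,t}=0$ and only the requirements of the existing vehicles. These do not depend on the prices. The station's profit is $p^{BU}_{k,l,t}-v^{BU}_{l,t}+v_{-k}$ if $(l,t,BU)$ is selected and $0$ if none is. Social welfare is user surplus (payoff) plus station profit. Ex-post social welfare maximization means that, for every realization of the utilities, the menu solves: maximize $\sum_{l,t,BU}(u^{BU}_{k,l,t}-v^{BU}_{l,t}+v_{-k})A^{BU}_{k,l,t}(\mathbf p_k)$ over $p^{BU}_{k,l,t}\ge0$. Linear program $\mathcal P^{BU}_{l,t_{\text{dead}}}$. $\mathcal K_0$: finite set of vehicles (EVs) already present; $i\in\mathcal K_0$ needs energy $N_i$ by deadline $w_i$ with remaining utilization allowance $BU_i$; put $N_k=l$, $w_k=t_{\text{dead}}$, $BU_k=BU$. Data: EV efficiencies $\eta_{i,c},\eta_{i,dc}\le1$, levels $\text{EV}^{i,\mathrm{ini}}$ at $t_k$, bounds $d_{i,\min},d_{i,\max}$, rate limits $R_{min},R_{max}$, harvested energy $\bar E^t$, storage capacity $B_{max}$, initial storage level $B^0$, station efficiencies $\eta_{c,cs},\eta_{d,cs}$, unit buying and selling prices $c_t\ge g_t$. Minimize $\sum_{t=t_k}^{T-1}(c_tq_t-g_tx_t)$ over $q_t,x_t,e_t,s_t,r^+_{i,t},r^-_{i,t}\ge0$ and real $r_{i,t},\text{EV}_{i,t},B^t$ subject to, for all relevant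 $t$ and $i\in\mathcal K_0\cup\{k\}$: $\sum_{t=t_k}^{w_i-1}r_{i,t}\ge N_i$; $r_{i,t}=r^+_{i,t}-r^-_{i,t}$, $R_{min}\le r_{i,t}\le R_{max}$; $r_{t,\text{charge}}=\sum_ir^+_{i,t}/\eta_{i,c}$, $r_{t,\text{discharge}}=\sum_i\eta_{i,dc}r^-_{i,t}$; $\text{EV}_{i,t+1}=\text{EV}_{i,t}+r_{i,t}$, $\text{EV}_{i,t_k}=\text{EV}^{i,\mathrm{ini}}$, $d_{i,\min}\le\text{EV}_{i,t}\le d_{i,\max}$; $B^{t+1}=B^t+\bar E^t\eta_{c,cs}-e_t/\eta_{d,cs}+s_t\eta_{c,cs}$, $0\le B^{t+1}\le B_{max}$, initial level $B^0$, $B^T=B^0$; $q_t-r_{t,\text{charge}}+r_{t,\text{discharge}}-x_t=s_t-e_t$; $\sum_{t=t_k}^{w_i-1}(r^+_{i,t}+r^-_{i,t})-N_i\le BU_i$. An EV takes part only before its deadline.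
   Formalization: Optimality over p ≥ 0 is claimed only if each contract has L ≥ 0 or v ≥ v_{-k} (else the price can be negative); over menus of any sign it is unconditional. Assumed: feasibility without user k, c_t ≥ 0, all efficiencies in (0,1]. "Every realization" means almost every. *)

theory Defs
  imports "HOL-Probability.Probability"
begin

record vehicle =
  eff_c :: real
  eff_dc :: real
  init_level :: real
  level_min :: real
  level_max :: real
  energy_need :: real
  deadline :: nat
  util_allowance :: real

text \<open>
  The arriving user is the index \<open>user\<close>. The fields \<open>energy_need\<close>, \<open>deadline\<close> and \<open>util_allowance\<close>
  of her vehicle are placeholders: they are overwritten by the contract under consideration.
\<close>

record 'i station =
  present :: "'i set"
  user :: 'i
  ev :: "'i \<Rightarrow> vehicle"
  arrival :: nat
  horizon :: nat
  max_energy :: nat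
  max_util :: nat
  rate_min :: real
  rate_max :: real
  harvest :: "nat \<Rightarrow> real"
  storage_cap :: real
  storage_init :: real
  eff_in :: real
  eff_out :: real
  buy_price :: "nat \<Rightarrow> real"
  sell_price :: "nat \<Rightarrow> real"

definition valid_station :: "'i station \<Rightarrow> bool" where
  "valid_station D \<longleftrightarrow>
     finite (present D) \<and> user D \<notin> present D \<and>
     arrival D < horizon D \<and> 1 \<le> max_energy D \<and>
     (\<forall>i\<in>insert (user D) (present D).
        0 < eff_c (ev D i) \<and> eff_c (ev D i) \<le> 1 \<and>
        0 < eff_dc (ev D i) \<and> eff_dc (ev D i) \<le> 1) \<and>
     0 < eff_in D \<and> eff_in D \<le> 1 \<and> 0 < eff_out D \<and> eff_out D \<le> 1 \<and>
     (\<forall>t\<in>{arrival D..<horizon D}. sell_price D t \<le> buy_price D t \<and> 0 \<le> buy_price D t)"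

record 'i plan =
  bought :: "nat \<Rightarrow> real"
  sold :: "nat \<Rightarrow> real"
  stor_out :: "nat \<Rightarrow> real"
  stor_in :: "nat \<Rightarrow> real"
  rate_pos :: "'i \<Rightarrow> nat \<Rightarrow> real"
  rate_neg :: "'i \<Rightarrow> nat \<Rightarrow> real"
  rate :: "'i \<Rightarrow> nat \<Rightarrow> real"
  level :: "'i \<Rightarrow> nat \<Rightarrow> real"
  storage :: "nat \<Rightarrow> real"

text \<open>
  \<open>I\<close> is the set of participating vehicles and \<open>V\<close> their data. Vehicle \<open>i\<close> contributes to the
  station's balance only at times before its deadline.
\<close>

definition total_charge :: "'i set \<Rightarrow> ('i \<Rightarrow> vehicle) \<Rightarrow> 'i plan \<Rightarrow> nat \<Rightarrow> real" where
  "total_charge I V y t = (\<Sum>i\<in>{i\<in>I. t < deadline (V i)}. rate_pos y i t / eff_c (V i))"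

definition total_discharge :: "'i set \<Rightarrow> ('i \<Rightarrow> vehicle) \<Rightarrow> 'i plan \<Rightarrow> nat \<Rightarrow> real" where
  "total_discharge I V y t = (\<Sum>i\<in>{i\<in>I. t < deadline (V i)}. eff_dc (V i) * rate_neg y i t)"

definition vehicle_feasible :: "'i station \<Rightarrow> vehicle \<Rightarrow> 'i \<Rightarrow> 'i plan \<Rightarrow> bool" where
  "vehicle_feasible D W i y \<longleftrightarrow>
     (\<Sum>t\<in>{arrival D..<deadline W}. rate y i t) \<ge> energy_need W \<and>
     (\<forall>t\<in>{arrival D..<deadline W}.
        0 \<le> rate_pos y i t \<and> 0 \<le> rate_neg y i t \<and>
        rate y i t = rate_pos y i t - rate_neg y i t \<and>
        rate_min D \<le> rate y i t \<and> rate y i t \<le> rate_max D \<and>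
        level y i (Suc t) = level y i t + rate y i t) \<and>
     level y i (arrival D) = init_level W \<and>
     (\<forall>t\<in>{arrival D..deadline W}. level_min W \<le> level y i t \<and> level y i t \<le> level_max W) \<and>
     (\<Sum>t\<in>{arrival D..<deadline W}. rate_pos y i t + rate_neg y i t) - energy_need W
       \<le> util_allowance W"

definition station_feasible :: "'i station \<Rightarrow> 'i set \<Rightarrow> ('i \<Rightarrow> vehicle) \<Rightarrow> 'i plan \<Rightarrow> bool" where
  "station_feasible D I V y \<longleftrightarrow>
     storage y (arrival D) = storage_init D \<and> storage y (horizon D) = storage_init D \<and>
     (\<forall>t\<in>{arrival D..<horizon D}.
        0 \<le> bought y t \<and> 0 \<le> sold y t \<and> 0 \<le> stor_out y t \<and> 0 \<le> stor_in y t \<and>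
        storage y (Suc t) = storage y t + harvest D t * eff_in D
          - stor_out y t / eff_out D + stor_in y t * eff_in D \<and>
        0 \<le> storage y (Suc t) \<and> storage y (Suc t) \<le> storage_cap D \<and>
        bought y t - total_charge I V y t + total_discharge I V y t - sold y t
          = stor_in y t - stor_out y t)"

definition feasible_plans :: "'i station \<Rightarrow> 'i set \<Rightarrow> ('i \<Rightarrow> vehicle) \<Rightarrow> 'i plan set" where
  "feasible_plans D I V = {y. station_feasible D I V y \<and> (\<forall>i\<in>I. vehicle_feasible D (V i) i y)}"

definition plan_cost :: "'i station \<Rightarrow> 'i plan \<Rightarrow> real" where
  "plan_cost D y =
     (\<Sum>t\<in>{arrival D..<horizon D}. buy_price D t * bought y t - sell_price D t * sold y t)"

text \<open>The infimum is \<open>\<infinity>\<close> when there is no feasible plan.\<close>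

definition optimal_value :: "'i station \<Rightarrow> 'i set \<Rightarrow> ('i \<Rightarrow> vehicle) \<Rightarrow> ereal" where
  "optimal_value D I V = (INF y\<in>feasible_plans D I V. ereal (plan_cost D y))"

text \<open>A contract is a triple of energy, deadline and additional battery utilization.\<close>

type_synonym contract = "nat \<times> nat \<times> nat"

definition contracts :: "'i station \<Rightarrow> contract set" where
  "contracts D = {1..max_energy D} \<times> {arrival D + 1..horizon D} \<times> {0..max_util D}"

fun contract_vehicles :: "'i station \<Rightarrow> contract \<Rightarrow> 'i \<Rightarrow> vehicle" where
  "contract_vehicles D (l, t, b) = (ev D)(user D := (ev D (user D))
     \<lparr>energy_need := real l, deadline := t, util_allowance := real b\<rparr>)"

definition contract_value :: "'i station \<Rightarrow> contract \<Rightarrow> ereal" where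
  "contract_value D c =
     optimal_value D (insert (user D) (present D)) (contract_vehicles D c)"

text \<open>Without a contract the user's vehicle has zero rate, so it drops out of the program.\<close>

definition baseline_value :: "'i station \<Rightarrow> ereal" where
  "baseline_value D = optimal_value D (present D) (ev D)"

text \<open>
  Prices are extended reals because a contract with an infeasible program is priced at \<open>\<infinity>\<close>.
  The convention \<open>0 * \<infinity> = 0\<close> of \<^typ>\<open>ereal\<close> makes contracts that are not selected contribute
  nothing to the sums below.
\<close>

type_synonym menu = "contract \<Rightarrow> ereal"

definition nonneg_menus :: "'i station \<Rightarrow> menu set" where
  "nonneg_menus D = {p. \<forall>c\<in>contracts D. 0 \<le> p c}"

definition admissible :: "'i station \<Rightarrow> (contract \<Rightarrow> real) \<Rightarrow> bool" where
  "admissible D A \<longleftrightarrow>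
     (\<forall>c\<in>contracts D. 0 \<le> A c \<and> A c \<le> 1) \<and> (\<Sum>c\<in>contracts D. A c) \<le> 1"

definition user_payoff ::
    "'i station \<Rightarrow> (contract \<Rightarrow> real) \<Rightarrow> menu \<Rightarrow> (contract \<Rightarrow> real) \<Rightarrow> ereal" where
  "user_payoff D u p A = (\<Sum>c\<in>contracts D. ereal (A c) * (ereal (u c) - p c))"

text \<open>
  \<open>user_choice D u p A\<close>: \<open>A\<close> is a possible response of the user with utilities \<open>u\<close> to the menu \<open>p\<close>.
  The response is not unique when several contracts have maximum payoff.
\<close>

definition user_choice ::
    "'i station \<Rightarrow> (contract \<Rightarrow> real) \<Rightarrow> menu \<Rightarrow> (contract \<Rightarrow> real) \<Rightarrow> bool" where
  "user_choice D u p A \<longleftrightarrow>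
     admissible D A \<and>
     (\<forall>A'. admissible D A' \<longrightarrow> user_payoff D u p A' \<le> user_payoff D u p A) \<and>
     ((MAX c\<in>contracts D. ereal (u c) - p c) < 0 \<longrightarrow> (\<forall>c\<in>contracts D. A c = 0)) \<and>
     ((MAX c\<in>contracts D. ereal (u c) - p c) \<ge> 0 \<longrightarrow> (\<Sum>c\<in>contracts D. A c) = 1)"

definition station_profit :: "'i station \<Rightarrow> menu \<Rightarrow> (contract \<Rightarrow> real) \<Rightarrow> ereal" where
  "station_profit D p A =
     (\<Sum>c\<in>contracts D. ereal (A c) * (p c - contract_value D c + baseline_value D))"

definition social_welfare ::
    "'i station \<Rightarrow> (contract \<Rightarrow> real) \<Rightarrow> (contract \<Rightarrow> real) \<Rightarrow> ereal" where
  "social_welfare D u A =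
     (\<Sum>c\<in>contracts D. (ereal (u c) - contract_value D c + baseline_value D) * ereal (A c))"

text \<open>
  \<open>U c\<close> is the random utility of contract \<open>c\<close>, and a realization is a sample point outside a null
  set. The menu \<open>p\<close> may not depend on the realization, whereas a competing menu may. The comparison
  holds for every way in which ties are resolved.
\<close>

definition maximizes_ex_post_welfare ::
    "'i station \<Rightarrow> 'w measure \<Rightarrow> (contract \<Rightarrow> 'w \<Rightarrow> real) \<Rightarrow> menu set \<Rightarrow> menu \<Rightarrow> bool" where
  "maximizes_ex_post_welfare D M U P p \<longleftrightarrow>
     p \<in> P \<and>
     (AE \<omega> in M. \<forall>A. user_choice D (\<lambda>c. U c \<omega>) p A \<longrightarrow>
        (\<forall>p'\<in>P. \<forall>A'. user_choice D (\<lambda>c. U c \<omega>) p' A' \<longrightarrow>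
           social_welfare D (\<lambda>c. U c \<omega>) A' \<le> social_welfare D (\<lambda>c. U c \<omega>) A))"

text \<open>The value is \<open>-\<infinity>\<close> for a distribution that is unbounded below.\<close>

definition lowest_endpoint :: "'w measure \<Rightarrow> ('w \<Rightarrow> real) \<Rightarrow> ereal" where
  "lowest_endpoint M X = (INF x\<in>{x. 0 < cdf (distr M borel X) x}. ereal x)"

definition guaranteed_surplus ::
    "'i station \<Rightarrow> 'w measure \<Rightarrow> (contract \<Rightarrow> 'w \<Rightarrow> real) \<Rightarrow> ereal" where
  "guaranteed_surplus D M U =
     max (MAX c\<in>contracts D. lowest_endpoint M (U c) - contract_value D c + baseline_value D) 0"

definition pricing_strategy ::
    "'i station \<Rightarrow> 'w measure \<Rightarrow> (contract \<Rightarrow> 'w \<Rightarrow> real) \<Rightarrow> menu" where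
  "pricing_strategy D M U c =
     contract_value D c - baseline_value D + guaranteed_surplus D M U"

end

theory Submission
  imports Defs
begin

text \<open>
  Write \<open>w c = u c - v c + v0\<close> for the welfare of contract \<open>c\<close>. The proposed prices make the payoff
  of every contract equal to \<open>w c - G\<close> with the same constant \<open>G \<ge> 0\<close>, so the user selects
  contracts of maximum welfare. She rejects only if every \<open>w c\<close> is below \<open>G\<close>; as utilities are almost
  surely above their lowest end-points, this forces \<open>G = 0\<close>, and rejecting is then optimal too.
  The station earns \<open>G\<close> on each contract it sells. The remaining point is that the linear
  programs are bounded below, so that no value is \<open>-\<infinity>\<close>.
\<close>

section \<open>Boundedness of the linear programs\<close>

text \<open>The utilization constraint caps the whole battery throughput of a vehicle before its
  deadline by need plus allowance, hence also its discharge in a single slot. Absolute values let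
  the sum run over all of \<open>I\<close>, whichever vehicles are still connected.\<close>

lemma total_discharge_le:
  assumes fin: "finite I"
    and eff: "\<And>i. i \<in> I \<Longrightarrow> 0 < eff_dc (V i) \<and> eff_dc (V i) \<le> 1"
    and feas: "\<And>i. i \<in> I \<Longrightarrow> vehicle_feasible D (V i) i y"
    and t: "arrival D \<le> t"
  shows "total_discharge I V y t \<le> (\<Sum>i\<in>I. \<bar>energy_need (V i) + util_allowance (V i)\<bar>)"
proof -
  have "eff_dc (V i) * rate_neg y i t \<le> \<bar>energy_need (V i) + util_allowance (V i)\<bar>"
    if i: "i \<in> I" and d: "t < deadline (V i)" for i
  proof -
    have nonneg: "0 \<le> rate_pos y i s \<and> 0 \<le> rate_neg y i s"
      if "s \<in> {arrival D..<deadline (V i)}" for s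
      using feas[OF i] that unfolding vehicle_feasible_def by blast
    have tin: "t \<in> {arrival D..<deadline (V i)}" using t d by simp
    have "eff_dc (V i) * rate_neg y i t \<le> rate_neg y i t"
      using eff[OF i] nonneg[OF tin] by (intro mult_left_le_one_le) auto
    also have "\<dots> \<le> rate_pos y i t + rate_neg y i t" using nonneg[OF tin] by simp
    also have "\<dots> \<le> (\<Sum>s\<in>{arrival D..<deadline (V i)}. rate_pos y i s + rate_neg y i s)"
      using tin nonneg by (intro member_le_sum) (auto intro: add_nonneg_nonneg)
    also have "\<dots> \<le> energy_need (V i) + util_allowance (V i)"
      using feas[OF i] unfolding vehicle_feasible_def by linarith
    finally show ?thesis by linarith
  qed
  then have "total_discharge I V y t
      \<le> (\<Sum>i\<in>{i\<in>I. t < deadline (V i)}. \<bar>energy_need (V i) + util_allowance (V i)\<bar>)"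
    unfolding total_discharge_def by (intro sum_mono) auto
  also have "\<dots> \<le> (\<Sum>i\<in>I. \<bar>energy_need (V i) + util_allowance (V i)\<bar>)"
    using fin by (intro sum_mono2) auto
  finally show ?thesis .
qed

lemma total_charge_nonneg:
  assumes eff: "\<And>i. i \<in> I \<Longrightarrow> 0 < eff_c (V i)"
    and feas: "\<And>i. i \<in> I \<Longrightarrow> vehicle_feasible D (V i) i y"
    and t: "arrival D \<le> t"
  shows "0 \<le> total_charge I V y t"
  unfolding total_charge_def
proof (intro sum_nonneg)
  fix i assume "i \<in> {i \<in> I. t < deadline (V i)}"
  then have i: "i \<in> I" and "t \<in> {arrival D..<deadline (V i)}" using t by auto
  then have "0 \<le> rate_pos y i t" using feas[OF i] unfolding vehicle_feasible_def by blast
  then show "0 \<le> rate_pos y i t / eff_c (V i)" using eff[OF i] by simp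
qed

text \<open>A round trip through the storage loses energy, so even unbounded simultaneous charging and
  discharging yields only a bounded net output.\<close>

lemma storage_net_output_le:
  assumes feas: "station_feasible D I V y"
    and eff: "0 < eff_in D" "eff_in D \<le> 1" "0 < eff_out D" "eff_out D \<le> 1"
    and t: "t \<in> {arrival D..<horizon D}"
  shows "stor_out y t - stor_in y t \<le> \<bar>storage_cap D\<bar> + \<bar>storage_init D\<bar> + \<bar>harvest D t\<bar>"
proof -
  let ?S = "\<bar>storage_cap D\<bar> + \<bar>storage_init D\<bar> + \<bar>harvest D t\<bar>"
  have step: "storage y (Suc s) \<le> storage_cap D" if "s \<in> {arrival D..<horizon D}" for s
    using feas that unfolding station_feasible_def by blast
  have at: "storage y (Suc t) = storage y t + harvest D t * eff_in D
      - stor_out y t / eff_out D + stor_in y t * eff_in D" "0 \<le> storage y (Suc t)"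
    "0 \<le> stor_in y t"
    using feas t unfolding station_feasible_def by blast+
  \<comment> \<open>The capacity constraint is stated for \<open>storage y (Suc s)\<close> only, so
    the level on arrival is bounded through \<open>storage_init D\<close>.\<close>
  have "storage y t \<le> \<bar>storage_cap D\<bar> + \<bar>storage_init D\<bar>"
  proof (cases "t = arrival D")
    case True
    then have "storage y t = storage_init D" using feas unfolding station_feasible_def by blast
    then show ?thesis by linarith
  next
    case False
    then obtain s where "t = Suc s" "s \<in> {arrival D..<horizon D}"
      using t by (cases t) auto
    then show ?thesis using step[of s] by simp
  qed
  moreover have "harvest D t * eff_in D \<le> \<bar>harvest D t\<bar>"
    using eff mult_mono[of "harvest D t" "\<bar>harvest D t\<bar>" "eff_in D" 1] by simp
  moreover have "stor_in y t * eff_in D \<le> stor_in y t"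
    using at(3) eff by (simp add: mult_left_le)
  ultimately have *: "stor_out y t / eff_out D \<le> ?S + stor_in y t" using at by linarith
  \<comment> \<open>Scaling by \<open>eff_out D\<close> leaves \<open>stor_in y t\<close> with
    coefficient at most 1, so it can be subtracted.\<close>
  have "stor_out y t = eff_out D * (stor_out y t / eff_out D)" using eff by simp
  also have "\<dots> \<le> eff_out D * (?S + stor_in y t)" using * eff by (intro mult_left_mono) auto
  also have "\<dots> \<le> ?S + stor_in y t" using eff at(3) by (intro mult_left_le_one_le) auto
  finally show ?thesis by simp
qed

text \<open>The energy balance turns the discharge and storage bounds into a lower bound on
  \<open>bought y t - sold y t\<close> that is the same for all plans. As a unit sold earns no more
  than a unit bought costs, the cost of each slot is bounded below as well.\<close>

lemma optimal_value_neq_MInfty: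
  assumes fin: "finite I"
    and effV: "\<And>i. i \<in> I \<Longrightarrow> 0 < eff_c (V i) \<and> 0 < eff_dc (V i) \<and> eff_dc (V i) \<le> 1"
    and eff: "0 < eff_in D" "eff_in D \<le> 1" "0 < eff_out D" "eff_out D \<le> 1"
    and price: "\<And>t. t \<in> {arrival D..<horizon D} \<Longrightarrow>
      sell_price D t \<le> buy_price D t \<and> 0 \<le> buy_price D t"
  shows "optimal_value D I V \<noteq> -\<infinity>"
proof -
  let ?K = "\<lambda>t. (\<Sum>i\<in>I. \<bar>energy_need (V i) + util_allowance (V i)\<bar>)
    + (\<bar>storage_cap D\<bar> + \<bar>storage_init D\<bar> + \<bar>harvest D t\<bar>)"
  have "(\<Sum>t\<in>{arrival D..<horizon D}. - (buy_price D t * ?K t)) \<le> plan_cost D y"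
    if y: "y \<in> feasible_plans D I V" for y
    unfolding plan_cost_def
  proof (intro sum_mono)
    fix t assume t: "t \<in> {arrival D..<horizon D}"
    have sf: "station_feasible D I V y" and vf: "\<And>i. i \<in> I \<Longrightarrow> vehicle_feasible D (V i) i y"
      using y unfolding feasible_plans_def by auto
    have bal: "bought y t - total_charge I V y t + total_discharge I V y t - sold y t
          = stor_in y t - stor_out y t" and nn: "0 \<le> sold y t"
      using sf t unfolding station_feasible_def by blast+
    have "0 \<le> total_charge I V y t"
      using effV vf t by (intro total_charge_nonneg[where D = D]) auto
    moreover have "total_discharge I V y t
        \<le> (\<Sum>i\<in>I. \<bar>energy_need (V i) + util_allowance (V i)\<bar>)"
      using effV vf t fin by (intro total_discharge_le[where D = D]) auto
    ultimately have "- ?K t \<le> bought y t - sold y t"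
      using bal storage_net_output_le[OF sf eff t] by linarith
    then have "buy_price D t * (- ?K t) \<le> buy_price D t * (bought y t - sold y t)"
      using price[OF t] by (intro mult_left_mono) auto
    moreover have "sell_price D t * sold y t \<le> buy_price D t * sold y t"
      using price[OF t] nn by (intro mult_right_mono) auto
    ultimately show "- (buy_price D t * ?K t)
        \<le> buy_price D t * bought y t - sell_price D t * sold y t"
      by (simp only: right_diff_distrib mult_minus_right)
  qed
  then have "ereal (\<Sum>t\<in>{arrival D..<horizon D}. - (buy_price D t * ?K t))
      \<le> optimal_value D I V"
    unfolding optimal_value_def by (intro INF_greatest) simp
  then show ?thesis by auto
qed

lemma baseline_value_neq_MInfty:
  assumes "valid_station D"
  shows "baseline_value D \<noteq> -\<infinity>"
  unfolding baseline_value_def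
  using assms unfolding valid_station_def by (intro optimal_value_neq_MInfty) auto

lemma baseline_value_neq_PInfty:
  assumes "feasible_plans D (present D) (ev D) \<noteq> {}"
  shows "baseline_value D \<noteq> \<infinity>"
proof -
  obtain y where "y \<in> feasible_plans D (present D) (ev D)" using assms by blast
  then have "baseline_value D \<le> ereal (plan_cost D y)"
    unfolding baseline_value_def optimal_value_def by (rule INF_lower)
  then show ?thesis by auto
qed

lemma contract_value_neq_MInfty:
  assumes "valid_station D"
  shows "contract_value D c \<noteq> -\<infinity>"
proof (cases c)
  case (fields l t b)
  show ?thesis
    unfolding contract_value_def fields
    using assms unfolding valid_station_def by (intro optimal_value_neq_MInfty) auto
qed

section \<open>Lowest end-points\<close>

text \<open>The distribution function tends to 1, so it is positive at some real.\<close>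

lemma lowest_endpoint_neq_PInfty:
  assumes "prob_space M" "X \<in> borel_measurable M"
  shows "lowest_endpoint M X \<noteq> \<infinity>"
proof -
  interpret prob_space "distr M borel X" using assms by (rule prob_space.prob_space_distr)
  interpret real_distribution "distr M borel X" by unfold_locales auto
  have "eventually (\<lambda>x. 0 < cdf (distr M borel X) x) at_top"
    using order_tendstoD(1)[OF cdf_lim_at_top_prob, of 0] by simp
  then obtain x where "0 < cdf (distr M borel X) x"
    by (meson eventually_at_top_linorder order_refl)
  then have "lowest_endpoint M X \<le> ereal x"
    unfolding lowest_endpoint_def by (intro INF_lower) simp
  then show ?thesis by auto
qed

text \<open>Below the end-point the distribution function vanishes, so \<open>X\<close> exceeds any
  fixed such level almost surely. Restricting to rational levels leaves countably many null sets,
  and density recovers the end-point itself.\<close>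

lemma AE_lowest_endpoint_le:
  assumes "prob_space M" and X: "X \<in> borel_measurable M"
  shows "AE \<omega> in M. lowest_endpoint M X \<le> ereal (X \<omega>)"
proof -
  interpret prob_space M by fact
  have "AE \<omega> in M. ereal (of_rat q) < lowest_endpoint M X \<longrightarrow> of_rat q < X \<omega>" for q :: rat
  proof (cases "ereal (of_rat q) < lowest_endpoint M X")
    case True
    have "\<not> 0 < cdf (distr M borel X) (of_rat q)"
    proof
      assume "0 < cdf (distr M borel X) (of_rat q)"
      then have "lowest_endpoint M X \<le> ereal (of_rat q)"
        unfolding lowest_endpoint_def by (intro INF_lower) simp
      then show False using True by simp
    qed
    then have "measure M {\<omega> \<in> space M. X \<omega> \<le> of_rat q} = 0"
      using X
      by (simp add: cdf_def measure_distr vimage_def Int_def conj_commute zero_less_measure_iff)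
    then have "emeasure M {\<omega> \<in> space M. X \<omega> \<le> of_rat q} = 0"
      by (simp add: emeasure_eq_measure)
    moreover have "{\<omega> \<in> space M. X \<omega> \<le> of_rat q} \<in> sets M" using X by measurable
    ultimately have "AE \<omega> in M. \<not> X \<omega> \<le> of_rat q"
      by (subst AE_iff_measurable[of _ M]) auto
    then show ?thesis by (auto simp: not_le)
  qed auto
  then have "AE \<omega> in M. \<forall>q::rat. ereal (of_rat q) < lowest_endpoint M X \<longrightarrow> of_rat q < X \<omega>"
    by (simp add: AE_all_countable)
  then show ?thesis
  proof eventually_elim
    case (elim \<omega>)
    show ?case
    proof (rule ccontr)
      assume "\<not> ?thesis"
      \<comment> \<open>The end-point may be infinite, so a real level is inserted first and a
        rational one below it afterwards.\<close>
      then obtain r where r: "X \<omega> < r" "ereal r < lowest_endpoint M X"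
        using ereal_dense2[of "ereal (X \<omega>)" "lowest_endpoint M X"] by (meson ereal_less(2) less_ereal.simps(1) not_le)
      obtain q :: rat where q: "X \<omega> < of_rat q" "of_rat q < r"
        using of_rat_dense[OF r(1)] by blast
      then have "ereal (of_rat q) < lowest_endpoint M X"
        using r(2) by (meson ereal_less_eq(3) le_less_trans less_imp_le)
      then show False using elim q(1) by fastforce
    qed
  qed
qed

section \<open>Welfare of the user's responses\<close>

lemma finite_contracts: "finite (contracts D)"
  by (simp add: contracts_def)

lemma contracts_nonempty: "valid_station D \<Longrightarrow> contracts D \<noteq> {}"
  by (auto simp: contracts_def valid_station_def)

text \<open>The missing mass stands for rejection, which is worth 0; this is why \<open>m\<close>
  must be nonnegative.\<close>

lemma weighted_sum_le_max:
  fixes w :: "'c \<Rightarrow> ereal"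
  assumes nonneg: "\<And>c. c \<in> C \<Longrightarrow> 0 \<le> a c" and sum: "sum a C \<le> 1"
    and le: "\<And>c. c \<in> C \<Longrightarrow> w c \<le> m" and m: "0 \<le> m"
  shows "(\<Sum>c\<in>C. w c * ereal (a c)) \<le> m"
proof -
  have "(\<Sum>c\<in>C. w c * ereal (a c)) \<le> (\<Sum>c\<in>C. m * ereal (a c))"
    using nonneg le by (intro sum_mono ereal_mult_right_mono) auto
  also have "\<dots> = m * ereal (sum a C)"
    using nonneg by (subst sum_ereal_right_distrib[symmetric]) (auto simp: sum_ereal)
  also have "\<dots> \<le> m * 1"
    using sum m by (intro ereal_mult_left_mono) (auto simp: one_ereal_def)
  finally show ?thesis by simp
qed

text \<open>With no summand equal to \<open>\<infinity>\<close>, a single positively weighted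
  \<open>-\<infinity>\<close> would pull the whole sum down to \<open>-\<infinity>\<close>.\<close>

lemma weighted_sum_finite_support:
  fixes f :: "'c \<Rightarrow> ereal"
  assumes fin: "finite C" and nonneg: "\<And>c. c \<in> C \<Longrightarrow> 0 \<le> a c"
    and f: "\<And>c. c \<in> C \<Longrightarrow> f c \<noteq> \<infinity>" and sum: "(\<Sum>c\<in>C. ereal (a c) * f c) \<noteq> -\<infinity>"
    and c: "c \<in> C" "a c \<noteq> 0"
  shows "f c \<noteq> -\<infinity>"
proof
  assume "f c = -\<infinity>"
  then have eq: "ereal (a c) * f c = -\<infinity>" using c nonneg[of c] by simp
  have "ereal (a i) * f i \<noteq> \<infinity>" if "i \<in> C" for i
    using f[OF that] nonneg[OF that] by (cases "f i") auto
  then have "(\<Sum>c\<in>C - {c}. ereal (a c) * f c) \<noteq> \<infinity>"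
    by (auto simp: sum_Pinfty)
  then have "(\<Sum>c\<in>C. ereal (a c) * f c) = -\<infinity>"
    using fin c(1) eq by (subst sum.remove[of C c]) auto
  then show False using sum by simp
qed

text \<open>One realization, with \<open>w\<close> the welfare of the contracts and \<open>g\<close>
  the guaranteed surplus. Infeasible contracts have \<open>w c = -\<infinity>\<close>. The
  distribution of the utilities survives only in \<open>g_le\<close>.\<close>

locale charging_market =
  fixes D :: "'i station" and w :: "contract \<Rightarrow> ereal" and g :: real
    and u :: "contract \<Rightarrow> real" and p :: menu and A :: "contract \<Rightarrow> real"
  assumes nonempty: "contracts D \<noteq> {}"
    and w_neq: "\<And>c. c \<in> contracts D \<Longrightarrow> w c \<noteq> \<infinity>"
    and payoff: "\<And>c. c \<in> contracts D \<Longrightarrow> ereal (u c) - p c = w c - ereal g"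
    and choice: "user_choice D u p A"
    and g_le: "0 < g \<Longrightarrow> \<exists>c\<in>contracts D. ereal g \<le> w c"
    and g_nonneg: "0 \<le> g"
begin

lemma A_nonneg: "c \<in> contracts D \<Longrightarrow> 0 \<le> A c"
  using choice unfolding user_choice_def admissible_def by blast

lemma rejects:
  assumes "\<And>c. c \<in> contracts D \<Longrightarrow> w c < ereal g"
  shows "g = 0" "\<And>c. c \<in> contracts D \<Longrightarrow> A c = 0"
proof -
  show "g = 0" using assms g_le g_nonneg by fastforce
  have "(MAX c\<in>contracts D. ereal (u c) - p c) < 0"
  proof (subst Max_less_iff)
    show "\<forall>x\<in>(\<lambda>c. ereal (u c) - p c) ` contracts D. x < 0"
      using assms payoff \<open>g = 0\<close> by (auto simp: zero_ereal_def[symmetric])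
  qed (use nonempty finite_contracts in auto)
  then show "A c = 0" if "c \<in> contracts D" for c
    using choice that unfolding user_choice_def by blast
qed

text \<open>The payoff of \<open>b\<close> is nonnegative, so the tie rule forces total weight 1.
  Optimality against choosing \<open>b\<close> alone compares sums of \<open>w c - ereal g\<close>,
  and with both total weights equal to 1 the constant cancels.\<close>

lemma accepts:
  assumes b: "b \<in> contracts D" and wb: "ereal g \<le> w b"
    and best: "\<And>c. c \<in> contracts D \<Longrightarrow> w c \<le> w b"
  shows "sum A (contracts D) = 1"
    and "\<And>c. c \<in> contracts D \<Longrightarrow> A c \<noteq> 0 \<Longrightarrow> w c \<noteq> -\<infinity>"
    and "(\<Sum>c\<in>contracts D. w c * ereal (A c)) \<ge> w b"
proof -
  have "0 \<le> ereal (u b) - p b"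
    using wb payoff[OF b] by (cases "w b") auto
  also have "\<dots> \<le> (MAX c\<in>contracts D. ereal (u c) - p c)"
    using b finite_contracts by (intro Max_ge) auto
  finally show sum1: "sum A (contracts D) = 1"
    using choice unfolding user_choice_def by blast
  \<comment> \<open>The competing response that selects \<open>b\<close> with certainty.\<close>
  define e where "e = (\<lambda>c. if c = b then 1 else 0 :: real)"
  have "admissible D e"
    using b finite_contracts[of D] by (simp add: admissible_def e_def)
  moreover have "\<forall>A'. admissible D A' \<longrightarrow> user_payoff D u p A' \<le> user_payoff D u p A"
    using choice unfolding user_choice_def by (elim conjE)
  ultimately have "user_payoff D u p e \<le> user_payoff D u p A" by simp
  moreover have "user_payoff D u p e = (\<Sum>c\<in>contracts D. if c = b then ereal (u c) - p c else 0)"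
    unfolding user_payoff_def e_def by (intro sum.cong) (auto simp: one_ereal_def[symmetric])
  moreover have "user_payoff D u p A = (\<Sum>c\<in>contracts D. ereal (A c) * (w c - ereal g))"
    unfolding user_payoff_def by (intro sum.cong) (auto simp: payoff)
  ultimately have opt: "w b - ereal g \<le> (\<Sum>c\<in>contracts D. ereal (A c) * (w c - ereal g))"
    using b payoff[OF b] by (simp add: finite_contracts)
  show supp: "w c \<noteq> -\<infinity>" if "c \<in> contracts D" "A c \<noteq> 0" for c
  proof -
    have "w c - ereal g \<noteq> -\<infinity>"
    proof (rule weighted_sum_finite_support[where a = A and C = "contracts D"])
      show "w c - ereal g \<noteq> \<infinity>" if "c \<in> contracts D" for c
        using w_neq[OF that] by (cases "w c") auto
      show "(\<Sum>c\<in>contracts D. ereal (A c) * (w c - ereal g)) \<noteq> -\<infinity>"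
        using opt wb w_neq[OF b] by (cases "w b") auto
    qed (use that A_nonneg finite_contracts in auto)
    then show ?thesis by auto
  qed
  \<comment> \<open>Cancelling \<open>g\<close> needs real arithmetic. \<open>x\<close> agrees with
    \<open>w\<close> at \<open>b\<close> and wherever \<open>A\<close> is positive; elsewhere the
    weight 0 makes the values irrelevant.\<close>
  define x where "x = (\<lambda>c. real_of_ereal (w c))"
  have wx: "w c = ereal (x c)" if "c \<in> contracts D" "A c \<noteq> 0" for c
    using supp[OF that] w_neq[OF that(1)] unfolding x_def by (cases "w c") auto
  have wbx: "w b = ereal (x b)"
    using wb w_neq[OF b] unfolding x_def by (cases "w b") auto
  have "(\<Sum>c\<in>contracts D. ereal (A c) * (w c - ereal g))
      = (\<Sum>c\<in>contracts D. ereal (A c * (x c - g)))"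
  proof (intro sum.cong refl)
    fix c assume "c \<in> contracts D"
    then show "ereal (A c) * (w c - ereal g) = ereal (A c * (x c - g))"
      using wx[of c] by (cases "A c = 0") (auto simp: zero_ereal_def[symmetric])
  qed
  then have "x b - g \<le> (\<Sum>c\<in>contracts D. A c * (x c - g))"
    using opt wbx by (simp add: sum_ereal)
  also have "\<dots> = (\<Sum>c\<in>contracts D. x c * A c) - g"
    using sum1 by (simp add: right_diff_distrib sum_subtractf
        sum_distrib_left[symmetric] mult.commute)
  finally have "x b \<le> (\<Sum>c\<in>contracts D. x c * A c)" by simp
  moreover have "(\<Sum>c\<in>contracts D. w c * ereal (A c)) = (\<Sum>c\<in>contracts D. ereal (x c * A c))"
  proof (intro sum.cong refl)
    fix c assume "c \<in> contracts D"
    then show "w c * ereal (A c) = ereal (x c * A c)"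
      using wx[of c] by (cases "A c = 0") (auto simp: zero_ereal_def[symmetric])
  qed
  ultimately show "(\<Sum>c\<in>contracts D. w c * ereal (A c)) \<ge> w b"
    using wbx by (simp add: sum_ereal)
qed

lemma best_contract:
  obtains b where "b \<in> contracts D" "\<And>c. c \<in> contracts D \<Longrightarrow> w c \<le> w b"
proof -
  have "Max (w ` contracts D) \<in> w ` contracts D"
    using nonempty finite_contracts by (intro Max_in) auto
  then obtain b where "b \<in> contracts D" "w b = Max (w ` contracts D)" by fastforce
  then show ?thesis using that finite_contracts by (metis Max_ge finite_imageI imageI)
qed

text \<open>The competitor enters only as an admissible response, so every menu is covered, even one
  that depends on the realization. Its welfare is at most the larger of 0 and the best
  \<open>w b\<close>, and \<open>A\<close> attains this in both cases: by selling, or by rejecting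
  when all \<open>w c\<close> are negative.\<close>

lemma welfare_maximal:
  assumes A': "admissible D A'"
  shows "(\<Sum>c\<in>contracts D. w c * ereal (A' c)) \<le> (\<Sum>c\<in>contracts D. w c * ereal (A c))"
proof -
  obtain b where b: "b \<in> contracts D" and best: "\<And>c. c \<in> contracts D \<Longrightarrow> w c \<le> w b"
    using best_contract by blast
  have le: "(\<Sum>c\<in>contracts D. w c * ereal (A' c)) \<le> m" if "w b \<le> m" "0 \<le> m" for m
    using A' best that unfolding admissible_def
    by (intro weighted_sum_le_max) (auto intro: order_trans)
  show ?thesis
  proof (cases "ereal g \<le> w b")
    case True
    then have "0 \<le> w b" using g_nonneg by (meson ereal_less_eq(5) order_trans)
    then have "(\<Sum>c\<in>contracts D. w c * ereal (A' c)) \<le> w b" using le by simp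
    also have "\<dots> \<le> (\<Sum>c\<in>contracts D. w c * ereal (A c))" by (rule accepts(3)[OF b True best])
    finally show ?thesis .
  next
    case False
    then have less: "w c < ereal g" if "c \<in> contracts D" for c
      using best[OF that] by auto
    have "(\<Sum>c\<in>contracts D. w c * ereal (A c)) = 0"
      using rejects(2)[OF less] by (simp add: zero_ereal_def[symmetric])
    moreover have "w b \<le> 0"
      using less[OF b] rejects(1)[OF less] by (simp add: zero_ereal_def less_imp_le)
    ultimately show ?thesis using le[of 0] by simp
  qed
qed

text \<open>The margin \<open>q\<close> is prescribed only where \<open>w\<close> is finite, since
  for an infeasible contract it has the form \<open>\<infinity> - \<infinity>\<close>; such
  contracts get weight 0. If the user rejects, then \<open>g = 0\<close>, which is the profit of no
  sale.\<close>

lemma profit_eq: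
  assumes q: "\<And>c. c \<in> contracts D \<Longrightarrow> w c \<noteq> -\<infinity> \<Longrightarrow> q c = ereal g"
  shows "(\<Sum>c\<in>contracts D. ereal (A c) * q c) = ereal g"
proof -
  obtain b where b: "b \<in> contracts D" and best: "\<And>c. c \<in> contracts D \<Longrightarrow> w c \<le> w b"
    using best_contract by blast
  show ?thesis
  proof (cases "ereal g \<le> w b")
    case True
    have "(\<Sum>c\<in>contracts D. ereal (A c) * q c) = (\<Sum>c\<in>contracts D. ereal (A c * g))"
    proof (intro sum.cong refl)
      fix c assume "c \<in> contracts D"
      then show "ereal (A c) * q c = ereal (A c * g)"
        using accepts(2)[OF b True best, of c] q[of c]
        by (cases "A c = 0") (auto simp: zero_ereal_def[symmetric])
    qed
    also have "\<dots> = ereal (sum A (contracts D) * g)"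
      by (simp add: sum_ereal sum_distrib_right)
    finally show ?thesis using accepts(1)[OF b True best] by simp
  next
    case False
    then have less: "w c < ereal g" if "c \<in> contracts D" for c
      using best[OF that] by auto
    show ?thesis
      using rejects[OF less] by (simp add: zero_ereal_def[symmetric])
  qed
qed

end

section \<open>The pricing strategy\<close>

text \<open>No end-point surplus is \<open>\<infinity>\<close>, and the positive part removes
  \<open>-\<infinity>\<close>.\<close>

lemma guaranteed_surplus_real:
  assumes "valid_station D" "feasible_plans D (present D) (ev D) \<noteq> {}" "prob_space M"
    and "\<And>c. c \<in> contracts D \<Longrightarrow> U c \<in> borel_measurable M"
  obtains g where "guaranteed_surplus D M U = ereal g" "0 \<le> g"
proof -
  let ?s = "\<lambda>c. lowest_endpoint M (U c) - contract_value D c + baseline_value D"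
  have "?s c \<noteq> \<infinity>" if "c \<in> contracts D" for c
    using lowest_endpoint_neq_PInfty[OF assms(3) assms(4)[OF that]]
      contract_value_neq_MInfty[OF assms(1), of c] baseline_value_neq_PInfty[OF assms(2)]
    by (cases "lowest_endpoint M (U c)"; cases "contract_value D c"; cases "baseline_value D") auto
  moreover have "(MAX c\<in>contracts D. ?s c) \<in> ?s ` contracts D"
    using contracts_nonempty[OF assms(1)] finite_contracts by (intro Max_in) auto
  ultimately have "guaranteed_surplus D M U \<noteq> \<infinity>" "0 \<le> guaranteed_surplus D M U"
    unfolding guaranteed_surplus_def by (auto simp: max_def)
  then show ?thesis using that by (cases "guaranteed_surplus D M U") auto
qed

lemma endpoint_surplus_le_guaranteed:
  assumes "c \<in> contracts D"
  shows "lowest_endpoint M (U c) - contract_value D c + baseline_value D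
    \<le> guaranteed_surplus D M U"
proof -
  have "lowest_endpoint M (U c) - contract_value D c + baseline_value D
    \<le> (MAX c\<in>contracts D. lowest_endpoint M (U c) - contract_value D c + baseline_value D)"
    using assms finite_contracts by (intro Max_ge) auto
  then show ?thesis unfolding guaranteed_surplus_def by (simp add: le_max_iff_disj)
qed

lemma guaranteed_surplus_attained:
  assumes "valid_station D" "0 < guaranteed_surplus D M U"
  shows "\<exists>c\<in>contracts D. guaranteed_surplus D M U
    = lowest_endpoint M (U c) - contract_value D c + baseline_value D"
proof -
  let ?s = "\<lambda>c. lowest_endpoint M (U c) - contract_value D c + baseline_value D"
  have "(MAX c\<in>contracts D. ?s c) \<in> ?s ` contracts D"
    using contracts_nonempty[OF assms(1)] finite_contracts by (intro Max_in) auto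
  moreover have "guaranteed_surplus D M U = (MAX c\<in>contracts D. ?s c)"
    using assms(2) unfolding guaranteed_surplus_def by (auto simp: max_def split: if_splits)
  ultimately show ?thesis by auto
qed

text \<open>If the contract does not lower the station's cost, the price is a sum of nonnegative
  terms. Otherwise the guaranteed surplus is at least the surplus at the end-point of this contract,
  so the price is at least that end-point.\<close>

lemma pricing_strategy_nonneg:
  assumes "valid_station D" "feasible_plans D (present D) (ev D) \<noteq> {}" "prob_space M"
    and "\<And>c. c \<in> contracts D \<Longrightarrow> U c \<in> borel_measurable M"
    and nonneg: "\<forall>c\<in>contracts D. 0 \<le> lowest_endpoint M (U c) \<or> baseline_value D \<le> contract_value D c"
  shows "pricing_strategy D M U \<in> nonneg_menus D"
  unfolding nonneg_menus_def pricing_strategy_def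
proof (intro CollectI ballI)
  fix c assume c: "c \<in> contracts D"
  obtain g where g: "guaranteed_surplus D M U = ereal g" "0 \<le> g"
    using guaranteed_surplus_real[where U = U and M = M] assms by metis
  show "0 \<le> contract_value D c - baseline_value D + guaranteed_surplus D M U"
    using bspec[OF nonneg c] endpoint_surplus_le_guaranteed[OF c, of M U] g
      contract_value_neq_MInfty[OF assms(1), of c] baseline_value_neq_PInfty[OF assms(2)]
      baseline_value_neq_MInfty[OF assms(1)]
      lowest_endpoint_neq_PInfty[OF assms(3) assms(4)[OF c]]
    by (cases "lowest_endpoint M (U c)"; cases "contract_value D c"; cases "baseline_value D") auto
qed

text \<open>The exceptional null set depends only on the finitely many utilities, not on
  \<open>A\<close>, so one set serves every resolution of ties.\<close>

lemma AE_charging_market: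
  assumes "valid_station D" "feasible_plans D (present D) (ev D) \<noteq> {}" "prob_space M"
    and "\<And>c. c \<in> contracts D \<Longrightarrow> U c \<in> borel_measurable M"
    and g: "guaranteed_surplus D M U = ereal g" "0 \<le> g"
  shows "AE \<omega> in M. \<forall>A. user_choice D (\<lambda>c. U c \<omega>) (pricing_strategy D M U) A \<longrightarrow>
    charging_market D (\<lambda>c. ereal (U c \<omega>) - contract_value D c + baseline_value D) g
      (\<lambda>c. U c \<omega>) (pricing_strategy D M U) A"
proof -
  note fin = contract_value_neq_MInfty[OF assms(1)] baseline_value_neq_PInfty[OF assms(2)]
    baseline_value_neq_MInfty[OF assms(1)]
  have "AE \<omega> in M. \<forall>c\<in>contracts D. lowest_endpoint M (U c) \<le> ereal (U c \<omega>)"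
    using finite_contracts assms(3,4) by (intro AE_finite_allI AE_lowest_endpoint_le)
  then show ?thesis
  proof (eventually_elim, intro allI impI)
    fix \<omega> A
    assume L: "\<forall>c\<in>contracts D. lowest_endpoint M (U c) \<le> ereal (U c \<omega>)"
      and A: "user_choice D (\<lambda>c. U c \<omega>) (pricing_strategy D M U) A"
    let ?w = "\<lambda>c. ereal (U c \<omega>) - contract_value D c + baseline_value D"
    show "charging_market D ?w g (\<lambda>c. U c \<omega>) (pricing_strategy D M U) A"
    proof
      show "contracts D \<noteq> {}" by (rule contracts_nonempty) fact
      show "?w c \<noteq> \<infinity>" if "c \<in> contracts D" for c
        using fin(1)[of c] fin(2,3) by (cases "contract_value D c"; cases "baseline_value D") auto
      \<comment> \<open>For an infeasible contract both sides are
        \<open>-\<infinity>\<close>.\<close>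
      show "ereal (U c \<omega>) - pricing_strategy D M U c = ?w c - ereal g" if "c \<in> contracts D" for c
        using fin(1)[of c] fin(2,3) unfolding pricing_strategy_def g
        by (cases "contract_value D c"; cases "baseline_value D") auto
      show "\<exists>c\<in>contracts D. ereal g \<le> ?w c" if pos: "0 < g"
      proof -
        obtain c where c: "c \<in> contracts D"
          "ereal g = lowest_endpoint M (U c) - contract_value D c + baseline_value D"
          using guaranteed_surplus_attained[OF assms(1), of M U] pos g by auto
        \<comment> \<open>At the contract attaining the guaranteed surplus, replacing the end-point
          by the realized utility can only increase the value.\<close>
        have "ereal g \<le> ?w c"
          unfolding c(2) using L c(1) by (intro add_mono ereal_minus_mono) auto
        then show ?thesis using c(1) by blast
      qed
    qed (use A g in auto)
  qed
qed

text \<open>A contract that lowers the station's cost and has a negative end-point can receive a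
  negative price; hence the condition for nonnegative menus, beside the unconditional claim for
  arbitrary prices.\<close>

theorem theorem4:
  fixes D :: "'i station"
    and M :: "'w measure"
    and U :: "contract \<Rightarrow> 'w \<Rightarrow> real"
  assumes "valid_station D"
    and "feasible_plans D (present D) (ev D) \<noteq> {}"
    and "prob_space M"
    and "\<And>c. c \<in> contracts D \<Longrightarrow> U c \<in> borel_measurable M"
  shows "((\<forall>c\<in>contracts D. 0 \<le> lowest_endpoint M (U c) \<or> baseline_value D \<le> contract_value D c)
            \<longrightarrow> maximizes_ex_post_welfare D M U (nonneg_menus D) (pricing_strategy D M U)) \<and>
         maximizes_ex_post_welfare D M U UNIV (pricing_strategy D M U) \<and>
         (AE \<omega> in M. \<forall>A. user_choice D (\<lambda>c. U c \<omega>) (pricing_strategy D M U) A \<longrightarrow>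
            station_profit D (pricing_strategy D M U) A = guaranteed_surplus D M U)"
proof -
  obtain g where g: "guaranteed_surplus D M U = ereal g" "0 \<le> g"
    using guaranteed_surplus_real[where U = U and M = M] assms by metis
  have market: "AE \<omega> in M. \<forall>A. user_choice D (\<lambda>c. U c \<omega>) (pricing_strategy D M U) A \<longrightarrow>
    charging_market D (\<lambda>c. ereal (U c \<omega>) - contract_value D c + baseline_value D) g
      (\<lambda>c. U c \<omega>) (pricing_strategy D M U) A"
    using assms g by (intro AE_charging_market) auto
  \<comment> \<open>The class \<open>P\<close> matters only for membership of the proposed menu, so
    both welfare claims are instances.\<close>
  have welfare: "maximizes_ex_post_welfare D M U P (pricing_strategy D M U)"
    if "pricing_strategy D M U \<in> P" for P
    unfolding maximizes_ex_post_welfare_def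
  proof (intro conjI that)
    show "AE \<omega> in M. \<forall>A. user_choice D (\<lambda>c. U c \<omega>) (pricing_strategy D M U) A \<longrightarrow>
        (\<forall>p'\<in>P. \<forall>A'. user_choice D (\<lambda>c. U c \<omega>) p' A' \<longrightarrow>
           social_welfare D (\<lambda>c. U c \<omega>) A' \<le> social_welfare D (\<lambda>c. U c \<omega>) A)"
      using market
      by eventually_elim
        (auto simp: social_welfare_def user_choice_def[of _ _ _ "A'" for A']
          intro!: charging_market.welfare_maximal)
  qed
  have "AE \<omega> in M. \<forall>A. user_choice D (\<lambda>c. U c \<omega>) (pricing_strategy D M U) A \<longrightarrow>
      station_profit D (pricing_strategy D M U) A = guaranteed_surplus D M U"
    using market
  proof (eventually_elim, intro allI impI)
    fix \<omega> A
    assume "\<forall>A. user_choice D (\<lambda>c. U c \<omega>) (pricing_strategy D M U) A \<longrightarrow>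
      charging_market D (\<lambda>c. ereal (U c \<omega>) - contract_value D c + baseline_value D) g
        (\<lambda>c. U c \<omega>) (pricing_strategy D M U) A"
      and "user_choice D (\<lambda>c. U c \<omega>) (pricing_strategy D M U) A"
    then interpret charging_market D
      "\<lambda>c. ereal (U c \<omega>) - contract_value D c + baseline_value D" g
      "\<lambda>c. U c \<omega>" "pricing_strategy D M U" A by blast
    show "station_profit D (pricing_strategy D M U) A = guaranteed_surplus D M U"
      unfolding station_profit_def g(1)
    proof (rule profit_eq)
      fix c assume "c \<in> contracts D"
        "ereal (U c \<omega>) - contract_value D c + baseline_value D \<noteq> -\<infinity>"
      then show "pricing_strategy D M U c - contract_value D c + baseline_value D = ereal g"
        using contract_value_neq_MInfty[OF assms(1), of c] baseline_value_neq_PInfty[OF assms(2)]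
          baseline_value_neq_MInfty[OF assms(1)]
        unfolding pricing_strategy_def g
        by (cases "contract_value D c"; cases "baseline_value D") auto
    qed
  qed
  then show ?thesis
    using welfare pricing_strategy_nonneg[OF assms(1-3)] assms(4) by simp
qed

end
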